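(* Let $r,s\ge 0$ be integers with $r+s=m$, let $\mathbb{W}\subset\mathbb{R}^r$, let $P'\subset P$ be compact, and let $I$, $W$, $Z$ be non-empty open subsets of $\mathbb{R}_{\ge 0}$, $\operatorname{int}\mathbb{W}$, $\mathbb{R}^s$ respectively. Let $\mathbb{V}:\mathbb{R}_{\ge 0}\times\mathbb{R}^m\to\mathbb{R}$ enjoy the Dynamic Programming Principle (DPP). Assume that a function $S:Z\to\mathbb{R}$ and a positive locally Lipschitz continuous function $R:I\times\mathbb{W}\to\mathbb{R}_{>0}$ satisfy $$\mathbb{V}(t,(w,z))=R(t,w)\,S(z)\qquad\text{for all }(t,w,z)\in I\times\mathbb{W}\times Z.$$ Suppose that for every point of $I\times W\times Z$ there exist a neighborhood $I'\times W'\times Z'$ of this point and a positive $L$ such that $$Q'_{\mathbb{W}}(t',(w',z'),z)\le L\|z'-z\|\qquad\text{for all } t'\in I',\ w'\in W',\ z,z'\in Z'.$$ Then $\mathbb{V}$ is locally Lipschitz continuous on $I\times W\times Z$.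
   Context: Setting: $P$ is a complete separable metric space; $\mathbb{U}$ is the set of all Lebesgue measurable $u:\mathbb{R}_{\ge 0}\to P$ that are bounded on every compact time interval. The functions $f:\mathbb{R}_{\ge 0}\times\mathbb{R}^m\times P\to\mathbb{R}^m$ and $f_0:\mathbb{R}_{\ge 0}\times\mathbb{R}^m\times P\to\mathbb{R}$ are continuous and locally Lipschitz continuous in $x$, and $f$ satisfies the sublinear growth condition (at most linear growth in $\|x\|$), so that for each $(b,t)\in\mathbb{R}^m\times\mathbb{R}_{\ge 0}$ and $u\in\mathbb{U}$ the equation $\dot x=f(t,x,u(t))$ with $x(t)=b$ has a unique solution, extendable to all of $\mathbb{R}_{\ge 0}$, denoted $x_{b,t,u}$. DPP: a function $\mathbb{V}:\mathbb{R}_{\ge 0}\times\mathbb{R}^m\to\mathbb{R}\cup\{\pm\infty\}$ enjoys the Dynamic Programming Principle iff $\mathbb{V}(t,b)=\inf_{u\in\mathbb{U}}\big[\int_t^\tau f_0(s,x_{b,t,u}(s),u(s))\,ds+\mathbb{V}(\tau,x_{b,t,u}(\tau))\big]$ for all $b\in\mathbb{R}^m$ and $[t,\tau]\subset\mathbb{R}_{\ge 0}$. Points of $\mathbb{R}^m$ are written $(w,z)$ with $w\in\mathbb{R}^r$, $z\in\mathbb{R}^s$. Optimal-time function with controls restricted to $P'$: for $y'=(w',z')\in\mathbb{R}^m$, $z\in\mathbb{R}^s$, $t'\ge 0$, $$Q'_{\mathbb{W}}(t',y',z)=\inf\{\tau\ge 0 : \text{there is } u\in\mathbb{U}\text{ with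 } u(t)\in P'\text{ for all } t\ge 0\text{ and } x_{y',t',u}(t'+\tau)\in\mathbb{W}\times\{z\}\},$$ with $Q'_{\mathbb{W}}(t',y',z)=+\infty$ if no such motion exists. *)

theory Defs
  imports "HOL-Analysis.Analysis"
begin

text \<open>
  The state space is \<open>'w \<times> 'z\<close>, where \<open>'w\<close> and \<open>'z\<close> stand for the Euclidean spaces of
  dimensions r and s. Both dimensions may be 0, which \<open>real ^ 'n\<close> and the class
  \<open>euclidean_space\<close> exclude, so a Euclidean space is a real inner product space
  spanned by a finite set. The sorts \<open>banach\<close> and \<open>second_countable_topology\<close>, needed for the
  Bochner integral, hold automatically in such a space.

  Time runs over the nonnegative reals. Functions of time are total on \<open>real\<close>, but their values
  at negative times are never used.
\<close>

definition finite_dimensional :: "'a::real_vector itself \<Rightarrow> bool" where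
  "finite_dimensional _ \<longleftrightarrow> (\<exists>B::'a set. finite B \<and> span B = UNIV)"

definition controls :: "(real \<Rightarrow> 'p::polish_space) set" where
  "controls = {u. u \<in> borel_measurable (lebesgue_on {0..}) \<and>
                  (\<forall>a b. 0 \<le> a \<longrightarrow> bounded (u ` {a..b}))}"

text \<open>The growth constant may depend on the time horizon and on the bounded set of control values.\<close>

definition sublinear_growth ::
    "(real \<Rightarrow> 'x::real_normed_vector \<Rightarrow> 'p::metric_space \<Rightarrow> 'x) \<Rightarrow> bool" where
  "sublinear_growth f \<longleftrightarrow>
     (\<forall>T K. bounded K \<longrightarrow>
        (\<exists>c. \<forall>t\<in>{0..T}. \<forall>x. \<forall>p\<in>K. norm (f t x p) \<le> c * (1 + norm x)))"

definition locally_lipschitz_on :: "'a::metric_space set \<Rightarrow> ('a \<Rightarrow> 'b::metric_space) \<Rightarrow> bool" where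
  "locally_lipschitz_on X g \<longleftrightarrow>
     (\<forall>x\<in>X. \<exists>\<epsilon>>0. \<exists>L. L-lipschitz_on (cball x \<epsilon> \<inter> X) g)"

text \<open>
  \<open>motion f b t u x\<close>: on all of \<open>{0..}\<close>, \<open>x\<close> is the (Caratheodory) solution of
  \<open>x' = f(s, x, u(s))\<close> with \<open>x(t) = b\<close>. The integral is oriented, so \<open>s < t\<close> is covered.
  Being a solution is kept as a relation: whenever solutions exist and are unique, quantifying over
  \<open>x\<close> with \<open>motion f b t u x\<close> is the same as naming the solution determined by \<open>b\<close>, \<open>t\<close>, \<open>u\<close>.
\<close>

definition motion ::
    "(real \<Rightarrow> 'x \<Rightarrow> 'p \<Rightarrow> 'x::{banach, second_countable_topology}) \<Rightarrow>
     'x \<Rightarrow> real \<Rightarrow> (real \<Rightarrow> 'p) \<Rightarrow> (real \<Rightarrow> 'x) \<Rightarrow> bool" where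
  "motion f b t u x \<longleftrightarrow>
     (\<forall>s\<ge>0. interval_lebesgue_integrable lebesgue t s (\<lambda>\<sigma>. f \<sigma> (x \<sigma>) (u \<sigma>)) \<and>
            x s = b + interval_lebesgue_integral lebesgue t s (\<lambda>\<sigma>. f \<sigma> (x \<sigma>) (u \<sigma>)))"

text \<open>
  The Lebesgue integral with values in \<open>ereal\<close>, as the difference of the integrals of the positive
  and the negative part (\<open>\<infinity> - \<infinity> = \<infinity>\<close>). A bounded control may fail to be relatively compact, so
  the running cost need not be integrable; the Bochner integral would then silently be 0.
\<close>

definition extended_integral :: "'a measure \<Rightarrow> ('a \<Rightarrow> real) \<Rightarrow> ereal" where
  "extended_integral M g =
     enn2ereal (\<integral>\<^sup>+ s. ennreal (g s) \<partial>M) - enn2ereal (\<integral>\<^sup>+ s. ennreal (- g s) \<partial>M)"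

definition enjoys_DPP ::
    "(real \<Rightarrow> 'x \<Rightarrow> 'p \<Rightarrow> 'x) \<Rightarrow>
     (real \<Rightarrow> 'x::{banach, second_countable_topology} \<Rightarrow> 'p::polish_space \<Rightarrow> real) \<Rightarrow>
     (real \<Rightarrow> 'x \<Rightarrow> ereal) \<Rightarrow> bool" where
  "enjoys_DPP f f0 V \<longleftrightarrow>
     (\<forall>b t \<tau>. 0 \<le> t \<and> t \<le> \<tau> \<longrightarrow>
        V t b = Inf {extended_integral (lebesgue_on {t..\<tau>}) (\<lambda>s. f0 s (x s) (u s)) + V \<tau> (x \<tau>) | u x.
                     u \<in> controls \<and> motion f b t u x})"

definition optimal_time ::
    "(real \<Rightarrow> 'w \<times> 'z \<Rightarrow> 'p \<Rightarrow> 'w \<times> 'z) \<Rightarrow> 'p::polish_space set \<Rightarrow>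
     'w::{banach, second_countable_topology} set \<Rightarrow> real \<Rightarrow> 'w \<times> 'z \<Rightarrow>
     'z::{banach, second_countable_topology} \<Rightarrow> ereal" where
  "optimal_time f P' \<W> t' y' z =
     Inf {ereal \<tau> | \<tau>. 0 \<le> \<tau> \<and>
       (\<exists>u\<in>controls. (\<forall>t\<ge>0. u t \<in> P') \<and>
          (\<exists>x. motion f y' t' u x \<and> x (t' + \<tau>) \<in> \<W> \<times> {z}))}"

end

theory Submission
  imports Defs
begin

text \<open>
  On \<open>I \<times> \<W> \<times> Z\<close> the value function is the product \<open>R t w * S z\<close>, and \<open>R\<close> is locally Lipschitz. So
  it suffices that \<open>S\<close> is locally Lipschitz on \<open>Z\<close>. Fix a pair \<open>(t, w) \<in> I \<times> W\<close>.

  For \<open>y\<close>, \<open>z\<close> near a point of \<open>Z\<close>, the estimate on the optimal time gives a control with values in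
  \<open>P'\<close> that steers \<open>(w, y)\<close> in a time \<open>\<tau>\<close>, hardly longer than \<open>L * dist y z\<close>, to a point \<open>(v, z)\<close>
  with \<open>v \<in> \<W>\<close>. During such a short time the motion moves by at most \<open>C * \<tau>\<close> and the running cost
  stays below \<open>M\<close>, with \<open>C\<close> and \<open>M\<close> independent of the motion (lemma \<open>short_motions\<close>). The DPP,
  read as an inequality for this single control, says
  \<open>R t w * S y \<le> M * \<tau> + R (t + \<tau>) v * S z\<close>. Here \<open>R (t + \<tau>) v\<close> differs from \<open>R t w\<close> by
  \<open>O(\<tau>)\<close>, because both \<open>t + \<tau>\<close> and \<open>v\<close> have moved by \<open>O(\<tau>)\<close>. Dividing by \<open>R t w > 0\<close> gives
  \<open>S y - S z \<le> K * (1 + \<bar>S z\<bar>) * dist y z\<close> (lemma \<open>factor_increment\<close>).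

  The function \<open>S\<close> is not known to be locally bounded, but the inequality itself forces this:
  with \<open>z\<close> fixed it bounds \<open>S\<close> from above near \<open>z\<close>, and with \<open>y\<close> fixed it bounds \<open>S\<close> from below,
  since \<open>\<bar>S z\<bar>\<close> enters with a small factor. Then the factor \<open>1 + \<bar>S z\<bar>\<close> is bounded, and exchanging
  \<open>y\<close> and \<open>z\<close> makes the estimate two-sided
  (lemma \<open>lipschitz_near_if_self_bounding_increments\<close>).
\<close>

section \<open>Motions and costs over short times\<close>

text \<open>
  If \<open>N\<close> is the supremum of \<open>norm (x s)\<close>, the integral equation and the growth bound give
  \<open>N \<le> norm b + c * h * (1 + N)\<close>. Once \<open>N\<close> is known to be finite, \<open>c * h \<le> 1/2\<close> allows to solve this
  for \<open>N\<close>, and \<open>c * (1 + N)\<close> bounds the speed.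
\<close>

lemma motion_displacement:
  assumes mot: "motion f b t u x" and t: "0 \<le> t" and h: "0 \<le> h" and c: "0 \<le> c" "c * h \<le> 1/2"
    and growth: "\<And>s y. s \<in> {t..t+h} \<Longrightarrow> norm (f s y (u s)) \<le> c * (1 + norm y)"
    and s: "s \<in> {t..t+h}"
  shows "norm (x s - b) \<le> 2 * c * (1 + norm b) * (s - t)"
proof -
  define g where "g = (\<lambda>\<sigma>. f \<sigma> (x \<sigma>) (u \<sigma>))"
  have integrable: "set_integrable lebesgue {t<..<s} g"
    and x_eq: "x s - b = set_lebesgue_integral lebesgue {t<..<s} g"
    if "s \<in> {t..t+h}" for s
    using mot[unfolded motion_def, rule_format, of s] t that unfolding g_def
    by (simp_all add: interval_lebesgue_integrable_def interval_lebesgue_integral_def)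
  have norm_integrable: "set_integrable lebesgue {t<..<s} (\<lambda>\<sigma>. norm (g \<sigma>))"
    if "s \<in> {t..t+h}" for s
    using integrable_norm[OF integrable[OF that, unfolded set_integrable_def]]
    by (simp add: set_integrable_def)
  have x_le: "norm (x s - b) \<le> (LINT \<sigma>:{t<..<s}|lebesgue. norm (g \<sigma>))"
    if "s \<in> {t..t+h}" for s
    using integral_norm_bound[of lebesgue "\<lambda>\<sigma>. indicat_real {t<..<s} \<sigma> *\<^sub>R g \<sigma>"] x_eq[OF that]
    by (simp add: set_lebesgue_integral_def)
  have x_bound: "norm (x s - b) \<le> K * (s - t)"
    if s: "s \<in> {t..t+h}" and K: "\<And>\<sigma>. \<sigma> \<in> {t..t+h} \<Longrightarrow> norm (g \<sigma>) \<le> K" for s K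
  proof -
    have const: "set_integrable lebesgue {t<..<s} (\<lambda>_. K)"
      unfolding set_integrable_def
      using s by (intro integrable_scaleR_left integrable_real_indicator) auto
    have "(LINT \<sigma>:{t<..<s}|lebesgue. norm (g \<sigma>)) \<le> (LINT \<sigma>:{t<..<s}|lebesgue. K)"
      using norm_integrable[OF s] const
      by (rule set_integral_mono) (use s K in auto)
    also have "\<dots> = K * (s - t)"
      using s by (simp add: set_lebesgue_integral_def)
    finally show ?thesis using x_le[OF s] by linarith
  qed
  define N where "N = Sup ((\<lambda>s. norm (x s)) ` {t..t+h})"
  (* The integral of the norm over the whole interval is finite because the motion has an integrable
     velocity; this bounds x before any estimate of its size is available. *)
  have bdd: "bdd_above ((\<lambda>s. norm (x s)) ` {t..t+h})"
  proof (rule bdd_aboveI2)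
    fix s assume s: "s \<in> {t..t+h}"
    have "(LINT \<sigma>:{t<..<s}|lebesgue. norm (g \<sigma>)) \<le> (LINT \<sigma>:{t<..<t+h}|lebesgue. norm (g \<sigma>))"
      unfolding set_lebesgue_integral_def
    proof (rule integral_mono)
      show "integrable lebesgue (\<lambda>\<sigma>. indicat_real {t<..<s} \<sigma> *\<^sub>R norm (g \<sigma>))"
        using norm_integrable[OF s] by (simp add: set_integrable_def)
      show "integrable lebesgue (\<lambda>\<sigma>. indicat_real {t<..<t+h} \<sigma> *\<^sub>R norm (g \<sigma>))"
        using norm_integrable[of "t+h"] h by (simp add: set_integrable_def)
    qed (use s in \<open>auto simp: indicator_def\<close>)
    then show "norm (x s) \<le> norm b + (LINT \<sigma>:{t<..<t+h}|lebesgue. norm (g \<sigma>))"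
      using x_le[OF s] norm_triangle_ineq2[of "x s" b] by linarith
  qed
  have le_N: "norm (x s) \<le> N" if "s \<in> {t..t+h}" for s
    unfolding N_def using bdd that by (intro cSup_upper) auto
  have N0: "0 \<le> N" using order_trans[OF norm_ge_zero le_N[of t]] h by auto
  have g_le: "norm (g \<sigma>) \<le> c * (1 + N)" if "\<sigma> \<in> {t..t+h}" for \<sigma>
  proof -
    have "norm (g \<sigma>) \<le> c * (1 + norm (x \<sigma>))" unfolding g_def by (rule growth[OF that])
    also have "\<dots> \<le> c * (1 + N)" using le_N[OF that] c by (intro mult_left_mono) auto
    finally show ?thesis .
  qed
  have "N \<le> norm b + (1 + N) / 2"
    unfolding N_def
  proof (rule cSup_least)
    fix y assume "y \<in> (\<lambda>s. norm (x s)) ` {t..t+h}"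
    then obtain s where s: "s \<in> {t..t+h}" and y: "y = norm (x s)" by auto
    have "norm (x s - b) \<le> c * (1 + N) * (s - t)" by (rule x_bound[OF s g_le])
    also have "\<dots> \<le> c * (1 + N) * h" using s c N0 by (intro mult_left_mono) auto
    also have "\<dots> = c * h * (1 + N)" by simp
    also have "\<dots> \<le> 1/2 * (1 + N)" using c N0 by (intro mult_right_mono) auto
    finally show "y \<le> norm b + (1 + Sup ((\<lambda>s. norm (x s)) ` {t..t+h})) / 2"
      using norm_triangle_ineq2[of "x s" b] unfolding y N_def by argo
  qed (use h in auto)
  then have N_le: "1 + N \<le> 2 * (1 + norm b)" by argo
  have "norm (x s - b) \<le> c * (1 + N) * (s - t)" by (rule x_bound[OF s g_le])
  also have "\<dots> \<le> c * (2 * (1 + norm b)) * (s - t)"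
    using N_le c s by (intro mult_right_mono mult_left_mono) auto
  finally show ?thesis by (simp add: mult_ac)
qed

text \<open>
  The function is bounded on the compact slice \<open>{(t, b)} \<times> P\<close>. The bound, increased by 1, persists on
  an open set around the slice, and the tube lemma makes its width uniform in \<open>p \<in> P\<close>.
\<close>

lemma bounded_near_point_times_compact:
  fixes g :: "real \<Rightarrow> 'a::metric_space \<Rightarrow> 'p::metric_space \<Rightarrow> real"
  assumes cont: "continuous_on ({0..} \<times> UNIV \<times> UNIV) (\<lambda>(t, x, p). g t x p)"
    and P: "compact P" and t: "0 \<le> t"
  obtains \<delta> M where "0 < \<delta>" "0 \<le> M"
    "\<And>s y p. 0 \<le> s \<Longrightarrow> dist s t < \<delta> \<Longrightarrow> dist y b < \<delta> \<Longrightarrow> p \<in> P \<Longrightarrow> \<bar>g s y p\<bar> \<le> M"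
proof -
  let ?D = "({0..} \<times> UNIV) \<times> UNIV :: ((real \<times> 'a) \<times> 'p) set"
  let ?G = "\<lambda>((s, y), p). g s y p"
  have contG: "continuous_on ?D ?G"
  proof -
    have "continuous_on ?D ((\<lambda>(t, x, p). g t x p) \<circ> (\<lambda>((s, y), p). (s, y, p)))"
      by (rule continuous_on_compose)
        (auto simp: case_prod_unfold intro!: continuous_intros
          continuous_on_subset[OF cont[unfolded case_prod_unfold]])
    then show ?thesis by (simp add: comp_def case_prod_unfold)
  qed
  have "compact (?G ` ({(t, b)} \<times> P))"
    by (intro compact_continuous_image continuous_on_subset[OF contG] compact_Times P)
      (use t in auto)
  then obtain M where M: "\<And>p. p \<in> P \<Longrightarrow> \<bar>g t b p\<bar> \<le> M"
    by (fastforce dest!: compact_imp_bounded simp: bounded_iff)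
  obtain U where U: "open U" "U \<inter> ?D = ?G -` {- (\<bar>M\<bar> + 1)<..<\<bar>M\<bar> + 1} \<inter> ?D"
    using contG unfolding continuous_on_open_invariant by (meson open_greaterThanLessThan)
  have "{(t, b)} \<times> P \<subseteq> U"
  proof clarify
    fix p assume "p \<in> P"
    then have "((t, b), p) \<in> ?G -` {- (\<bar>M\<bar> + 1)<..<\<bar>M\<bar> + 1} \<inter> ?D"
      using M[of p] t by auto
    then show "((t, b), p) \<in> U" using U by blast
  qed
  then obtain X where X: "(t, b) \<in> X" "open X" "X \<times> P \<subseteq> U"
    using Elementary_Topology.tube_lemma[OF P U(1)] by blast
  then obtain e where e: "0 < e" "ball (t, b) e \<subseteq> X" using openE by blast
  show ?thesis
  proof (rule that[of "e/2" "\<bar>M\<bar> + 1"])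
    fix s y p assume *: "0 \<le> s" "dist s t < e/2" "dist y b < e/2" "p \<in> P"
    have "dist (t, b) (s, y) \<le> dist t s + dist b y"
      by (simp add: dist_Pair_Pair sqrt_sum_squares_le_sum)
    then have "(s, y) \<in> X" using * e by (auto simp: dist_commute)
    then have "((s, y), p) \<in> U \<inter> ?D" using X * by auto
    then show "\<bar>g s y p\<bar> \<le> \<bar>M\<bar> + 1" unfolding U(2) by auto
  qed (use e in auto)
qed

text \<open>
  The constants are uniform in the control and in the initial point \<open>b\<close> near \<open>b0\<close>. The growth
  condition bounds the displacement, so \<open>h\<close> can be chosen such that motions starting within \<open>h\<close> of
  \<open>b0\<close> do not leave the neighbourhood on which the cost is bounded.
\<close>

lemma short_motions:
  fixes f :: "real \<Rightarrow> 'x::{banach, second_countable_topology} \<Rightarrow> 'p::metric_space \<Rightarrow> 'x"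
    and f0 :: "real \<Rightarrow> 'x \<Rightarrow> 'p \<Rightarrow> real"
  assumes growth: "sublinear_growth f"
    and cont: "continuous_on ({0..} \<times> UNIV \<times> UNIV) (\<lambda>(t, x, p). f0 t x p)"
    and P: "compact P" and t: "0 \<le> t"
  obtains h C M where "0 < h" "0 \<le> C" "0 \<le> M"
    "\<And>b u x \<tau>. \<lbrakk>dist b b0 < h; \<forall>s\<ge>0. u s \<in> P; motion f b t u x; 0 \<le> \<tau>; \<tau> < h\<rbrakk> \<Longrightarrow>
       dist (x (t + \<tau>)) b \<le> C * \<tau> \<and> (\<forall>s\<in>{t..t+\<tau>}. \<bar>f0 s (x s) (u s)\<bar> \<le> M)"
proof -
  obtain \<delta> M where \<delta>: "0 < \<delta>" "0 \<le> M"
    and M: "\<And>s y p. 0 \<le> s \<Longrightarrow> dist s t < \<delta> \<Longrightarrow> dist y b0 < \<delta> \<Longrightarrow> p \<in> P \<Longrightarrow> \<bar>f0 s y p\<bar> \<le> M"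
    using bounded_near_point_times_compact[OF cont P t] by blast
  obtain c0 where c0: "\<And>s y p. s \<in> {0..t+1} \<Longrightarrow> p \<in> P \<Longrightarrow> norm (f s y p) \<le> c0 * (1 + norm y)"
    using growth[unfolded sublinear_growth_def, rule_format, OF compact_imp_bounded[OF P], of "t + 1"]
    by metis
  define c where "c = \<bar>c0\<bar>"
  have c: "norm (f s y p) \<le> c * (1 + norm y)" if "s \<in> {0..t+1}" "p \<in> P" for s y p
    using c0[OF that, of y] mult_right_mono[of c0 c "1 + norm y"] unfolding c_def
    by (smt (verit) norm_ge_zero)
  define C where "C = 2 * c * (2 + norm b0)"
  have c_pos: "0 \<le> c" and C_pos: "0 \<le> C" by (auto simp: c_def C_def)
  (* The four terms keep the time below the horizon t + 1, make motion_displacement applicable, and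
     leave half of the radius \<delta> each to the initial point and to the displacement. *)
  define h where "h = min (min 1 (1 / (2 * (c + 1)))) (min (\<delta> / 2) (\<delta> / (2 * (C + 1))))"
  have h_pos: "0 < h" using \<delta> c_pos C_pos unfolding h_def by simp
  have h: "h \<le> 1" "h \<le> 1 / (2 * (c + 1))" "h \<le> \<delta> / 2" "h \<le> \<delta> / (2 * (C + 1))"
    unfolding h_def by linarith+
  have ch: "c * h \<le> 1/2" and Ch: "C * h \<le> \<delta> / 2"
    using h h_pos c_pos C_pos by (auto simp: field_simps)
  show ?thesis
  proof (rule that[OF h_pos C_pos \<delta>(2)])
    fix b u x \<tau>
    assume b: "dist b b0 < h" and u: "\<forall>s\<ge>0. u s \<in> P" and mot: "motion f b t u x"
      and \<tau>: "0 \<le> \<tau>" "\<tau> < h"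
    have "norm b \<le> norm b0 + 1"
      using norm_triangle_ineq2[of b b0] b h(1) by (simp add: dist_norm)
    then have "c * (1 + norm b) \<le> c * (2 + norm b0)" using c_pos by (intro mult_left_mono) auto
    then have C: "2 * c * (1 + norm b) \<le> C" unfolding C_def by simp
    have disp: "dist (x s) b \<le> C * (s - t)" if s: "s \<in> {t..t+\<tau>}" for s
    proof -
      have "norm (x s - b) \<le> 2 * c * (1 + norm b) * (s - t)"
      proof (rule motion_displacement[OF mot t \<tau>(1) c_pos])
        show "c * \<tau> \<le> 1/2" using ch mult_left_mono[OF less_imp_le[OF \<tau>(2)] c_pos] by linarith
      qed (use c t u \<tau> h(1) s in auto)
      also have "\<dots> \<le> C * (s - t)" using C s by (intro mult_right_mono) auto
      finally show ?thesis by (simp add: dist_norm)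
    qed
    have "\<bar>f0 s (x s) (u s)\<bar> \<le> M" if s: "s \<in> {t..t+\<tau>}" for s
    proof (rule M)
      show "dist s t < \<delta>" using s \<tau> h(3) \<delta> by (auto simp: dist_real_def)
      have "C * (s - t) \<le> C * h" using s \<tau> C_pos by (intro mult_left_mono) auto
      then show "dist (x s) b0 < \<delta>"
        using disp[OF s] b dist_triangle[of "x s" b0 b] Ch h(3) by linarith
    qed (use s t u in auto)
    then show "dist (x (t + \<tau>)) b \<le> C * \<tau> \<and> (\<forall>s\<in>{t..t+\<tau>}. \<bar>f0 s (x s) (u s)\<bar> \<le> M)"
      using disp[of "t + \<tau>"] \<tau> by auto
  qed
qed

text \<open>
  The positive part of \<open>g\<close> is at most \<open>M\<close>, and the negative part contributes something nonnegative that
  is subtracted, possibly \<open>\<infinity>\<close>.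
\<close>

lemma extended_integral_le:
  assumes "a \<le> b" and "0 \<le> M" and "\<And>s. s \<in> {a..b} \<Longrightarrow> g s \<le> M"
  shows "extended_integral (lebesgue_on {a..b}) g \<le> ereal (M * (b - a))"
proof -
  have "(\<integral>\<^sup>+ s. ennreal (g s) \<partial>lebesgue_on {a..b}) \<le> (\<integral>\<^sup>+ s. ennreal M \<partial>lebesgue_on {a..b})"
    using assms by (intro nn_integral_mono ennreal_leI) auto
  also have "\<dots> = ennreal (M * (b - a))"
    using assms by (simp add: emeasure_restrict_space ennreal_mult)
  finally have "enn2ereal (\<integral>\<^sup>+ s. ennreal (g s) \<partial>lebesgue_on {a..b}) \<le> ereal (M * (b - a))"
    using assms by (metis diff_ge_0_iff_ge enn2ereal_ennreal less_eq_ennreal.rep_eq mult_nonneg_nonneg)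
  then show ?thesis
    unfolding extended_integral_def
    by (metis (no_types, lifting) enn2ereal_nonneg ereal_diff_le_mono_left)
qed

lemma DPP_upper_bound:
  fixes V :: "real \<Rightarrow> 'x::{banach, second_countable_topology} \<Rightarrow> real"
  assumes "enjoys_DPP f f0 (\<lambda>t b. ereal (V t b))" and "0 \<le> t" and "0 \<le> \<tau>" and "0 \<le> M"
    and "u \<in> controls" and "motion f b t u x"
    and "\<And>s. s \<in> {t..t+\<tau>} \<Longrightarrow> f0 s (x s) (u s) \<le> M"
  shows "V t b \<le> M * \<tau> + V (t + \<tau>) (x (t + \<tau>))"
proof -
  have "ereal (V t b) \<le> extended_integral (lebesgue_on {t..t+\<tau>}) (\<lambda>s. f0 s (x s) (u s))
      + ereal (V (t + \<tau>) (x (t + \<tau>)))"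
    using assms(1)[unfolded enjoys_DPP_def, rule_format, of t "t + \<tau>" b] assms(2-6)
    by (auto intro!: Inf_lower)
  also have "\<dots> \<le> ereal (M * \<tau>) + ereal (V (t + \<tau>) (x (t + \<tau>)))"
    using extended_integral_le[of t "t + \<tau>" M "\<lambda>s. f0 s (x s) (u s)"] assms
    by (intro add_right_mono) auto
  finally show ?thesis by simp
qed

section \<open>Locally Lipschitz real functions\<close>

text \<open>
  On a ball with \<open>K * \<eta> \<le> 1/2\<close> the increments between the centre \<open>a\<close> and \<open>z\<close> satisfy
  \<open>S z - S a \<le> (1 + \<bar>S a\<bar>) / 2\<close> and \<open>S a - S z \<le> (1 + \<bar>S z\<bar>) / 2\<close>. The second one can be solved for
  \<open>\<bar>S z\<bar>\<close> when \<open>S z < 0\<close>, so \<open>\<bar>S z\<bar> \<le> 2 * \<bar>S a\<bar> + 1\<close>.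
\<close>

lemma lipschitz_near_if_self_bounding_increments:
  fixes S :: "'a::metric_space \<Rightarrow> real"
  assumes "0 < \<epsilon>" and K: "0 \<le> K"
    and incr: "\<And>y z. y \<in> ball a \<epsilon> \<Longrightarrow> z \<in> ball a \<epsilon> \<Longrightarrow> S y - S z \<le> K * (1 + \<bar>S z\<bar>) * dist y z"
  obtains \<eta> L where "0 < \<eta>" "L-lipschitz_on (cball a \<eta>) S"
proof -
  define \<eta> where "\<eta> = min (\<epsilon> / 2) (1 / (2 * (K + 1)))"
  have \<eta>: "0 < \<eta>" "\<eta> < \<epsilon>" "K * \<eta> \<le> 1/2"
    using assms unfolding \<eta>_def by (auto simp: field_simps min_def)
  define B where "B = 2 * \<bar>S a\<bar> + 1"
  have S_bound: "\<bar>S z\<bar> \<le> B" if z: "z \<in> cball a \<eta>" for z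
  proof -
    have Kd: "K * dist z a \<le> 1/2"
      using z \<eta> K mult_left_mono[of "dist z a" \<eta> K] by (auto simp: dist_commute)
    have "S z - S a \<le> K * dist z a * (1 + \<bar>S a\<bar>)"
      using incr[of z a] z \<eta> by (simp add: mult_ac)
    also have "\<dots> \<le> 1/2 * (1 + \<bar>S a\<bar>)" using Kd by (intro mult_right_mono) auto
    finally have up: "S z - S a \<le> 1/2 * (1 + \<bar>S a\<bar>)" .
    have "S a - S z \<le> K * dist z a * (1 + \<bar>S z\<bar>)"
      using incr[of a z] z \<eta> by (simp add: mult_ac dist_commute)
    also have "\<dots> \<le> 1/2 * (1 + \<bar>S z\<bar>)" using Kd by (intro mult_right_mono) auto
    finally show ?thesis using up unfolding B_def by argo
  qed
  have half: "S y - S z \<le> K * (1 + B) * dist y z" if "y \<in> cball a \<eta>" "z \<in> cball a \<eta>" for y z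
  proof -
    have "S y - S z \<le> K * (1 + \<bar>S z\<bar>) * dist y z" using incr[of y z] that \<eta> by auto
    also have "\<dots> \<le> K * (1 + B) * dist y z"
      using S_bound[OF that(2)] K by (intro mult_right_mono mult_left_mono) auto
    finally show ?thesis .
  qed
  have "(K * (1 + B))-lipschitz_on (cball a \<eta>) S"
  proof (rule lipschitz_onI)
    fix y z assume "y \<in> cball a \<eta>" "z \<in> cball a \<eta>"
    then show "dist (S y) (S z) \<le> K * (1 + B) * dist y z"
      using half[of y z] half[of z y] by (auto simp: dist_real_def dist_commute abs_le_iff)
  qed (use K in \<open>auto simp: B_def\<close>)
  then show ?thesis using that \<eta>(1) by blast
qed

lemma lipschitz_on_mult_bounded:
  fixes g h :: "'a::metric_space \<Rightarrow> real"
  assumes g: "L-lipschitz_on X g" and h: "M-lipschitz_on X h"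
    and A: "0 \<le> A" "\<And>x. x \<in> X \<Longrightarrow> \<bar>g x\<bar> \<le> A" and B: "0 \<le> B" "\<And>x. x \<in> X \<Longrightarrow> \<bar>h x\<bar> \<le> B"
  shows "(A * M + L * B)-lipschitz_on X (\<lambda>x. g x * h x)"
proof (rule lipschitz_onI)
  have nonneg: "0 \<le> L" "0 \<le> M" using g h by (auto dest: lipschitz_on_nonneg)
  then show "0 \<le> A * M + L * B" using A B by simp
  fix x y assume xy: "x \<in> X" "y \<in> X"
  have "\<bar>g x * h x - g y * h y\<bar> = \<bar>g x * (h x - h y) + (g x - g y) * h y\<bar>"
    by (simp add: algebra_simps)
  also have "\<dots> \<le> \<bar>g x\<bar> * \<bar>h x - h y\<bar> + \<bar>g x - g y\<bar> * \<bar>h y\<bar>"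
    by (metis abs_mult abs_triangle_ineq)
  also have "\<dots> \<le> A * (M * dist x y) + (L * dist x y) * B"
    using lipschitz_onD[OF g xy] lipschitz_onD[OF h xy] A B xy nonneg
    by (intro add_mono mult_mono) (auto simp: dist_real_def)
  finally show "dist (g x * h x) (g y * h y) \<le> (A * M + L * B) * dist x y"
    by (simp add: dist_real_def algebra_simps)
qed

lemma lipschitz_on_bounded_value:
  fixes g :: "'a::metric_space \<Rightarrow> real"
  assumes "L-lipschitz_on (cball a \<epsilon> \<inter> X) g" and "a \<in> X" and "x \<in> cball a \<epsilon> \<inter> X"
  shows "\<bar>g x\<bar> \<le> \<bar>g a\<bar> + L * \<epsilon>"
proof -
  have "0 \<le> \<epsilon>" using assms(3) by (auto intro: order_trans[OF zero_le_dist])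
  then have "dist (g x) (g a) \<le> L * dist x a"
    using assms by (intro lipschitz_onD[OF assms(1)]) auto
  also have "\<dots> \<le> L * \<epsilon>"
    using assms by (intro mult_left_mono lipschitz_on_nonneg[OF assms(1)]) (auto simp: dist_commute)
  finally show ?thesis by (auto simp: dist_real_def)
qed

lemma locally_lipschitz_on_mult:
  fixes g h :: "'a::metric_space \<Rightarrow> real"
  assumes "locally_lipschitz_on X g" and "locally_lipschitz_on X h"
  shows "locally_lipschitz_on X (\<lambda>x. g x * h x)"
  unfolding locally_lipschitz_on_def
proof
  fix a assume a: "a \<in> X"
  obtain d1 L1 where 1: "0 < d1" "L1-lipschitz_on (cball a d1 \<inter> X) g"
    using assms(1) a unfolding locally_lipschitz_on_def by blast
  obtain d2 L2 where 2: "0 < d2" "L2-lipschitz_on (cball a d2 \<inter> X) h"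
    using assms(2) a unfolding locally_lipschitz_on_def by blast
  define d where "d = min d1 d2"
  have d: "0 < d" using 1 2 by (simp add: d_def)
  have g: "L1-lipschitz_on (cball a d \<inter> X) g" and h: "L2-lipschitz_on (cball a d \<inter> X) h"
    by (rule lipschitz_on_subset[OF 1(2)] lipschitz_on_subset[OF 2(2)], auto simp: d_def)+
  have "0 \<le> L1" "0 \<le> L2" using g h by (auto dest: lipschitz_on_nonneg)
  then show "\<exists>\<epsilon>>0. \<exists>L. L-lipschitz_on (cball a \<epsilon> \<inter> X) (\<lambda>x. g x * h x)"
    using d lipschitz_on_mult_bounded[OF g h _ lipschitz_on_bounded_value[OF g a]
        _ lipschitz_on_bounded_value[OF h a]]
    by (meson abs_ge_zero add_nonneg_nonneg less_imp_le mult_nonneg_nonneg)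
qed

lemma locally_lipschitz_on_compose_nonexpansive:
  assumes g: "locally_lipschitz_on Y g" and \<pi>: "\<pi> ` X \<subseteq> Y"
    and ne: "\<And>x y. dist (\<pi> x) (\<pi> y) \<le> dist x y"
  shows "locally_lipschitz_on X (\<lambda>x. g (\<pi> x))"
  unfolding locally_lipschitz_on_def
proof
  fix a assume a: "a \<in> X"
  then obtain d L where d: "0 < d" and L: "L-lipschitz_on (cball (\<pi> a) d \<inter> Y) g"
    using g \<pi> unfolding locally_lipschitz_on_def by blast
  have "L-lipschitz_on (cball a d \<inter> X) (\<lambda>x. g (\<pi> x))"
  proof (rule lipschitz_onI)
    show "0 \<le> L" using L by (rule lipschitz_on_nonneg)
    fix x y assume "x \<in> cball a d \<inter> X" "y \<in> cball a d \<inter> X"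
    then have "\<pi> x \<in> cball (\<pi> a) d \<inter> Y" "\<pi> y \<in> cball (\<pi> a) d \<inter> Y"
      using \<pi> ne by (auto intro: order_trans)
    then have "dist (g (\<pi> x)) (g (\<pi> y)) \<le> L * dist (\<pi> x) (\<pi> y)" by (rule lipschitz_onD[OF L])
    also have "\<dots> \<le> L * dist x y" using ne \<open>0 \<le> L\<close> by (intro mult_left_mono)
    finally show "dist (g (\<pi> x)) (g (\<pi> y)) \<le> L * dist x y" .
  qed
  then show "\<exists>\<epsilon>>0. \<exists>L. L-lipschitz_on (cball a \<epsilon> \<inter> X) (\<lambda>x. g (\<pi> x))" using d by blast
qed

lemma locally_lipschitz_on_transform:
  assumes "locally_lipschitz_on X g" and "\<And>x. x \<in> X \<Longrightarrow> g x = h x"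
  shows "locally_lipschitz_on X h"
  using assms unfolding locally_lipschitz_on_def by (metis IntD2 lipschitz_on_transform)

section \<open>The dynamic programming step\<close>

lemma le_mult_limit:
  fixes a k q r :: real
  assumes "q < r" "0 \<le> k" "\<And>\<sigma>. q < \<sigma> \<Longrightarrow> \<sigma> < r \<Longrightarrow> a \<le> k * \<sigma>"
  shows "a \<le> k * q"
proof (rule tendsto_lowerbound)
  show "((\<lambda>\<sigma>. k * \<sigma>) \<longlongrightarrow> k * q) (at_right q)" by (intro tendsto_intros)
  show "\<forall>\<^sub>F \<sigma> in at_right q. a \<le> k * \<sigma>"
    using assms eventually_at_right[OF assms(1)] by auto
qed simp

text \<open>
  The estimate, with constants depending on the fixed pair \<open>(t, w)\<close>, comes
  from comparing the value at \<open>(w, y)\<close> with that at the end of a nearly optimal motion to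
  \<open>\<W> \<times> {z}\<close>.
\<close>

lemma factor_increment:
  fixes f :: "real \<Rightarrow> 'w::{banach, second_countable_topology} \<times> 'z::{banach, second_countable_topology}
              \<Rightarrow> 'p::polish_space \<Rightarrow> 'w \<times> 'z"
    and V :: "real \<Rightarrow> 'w \<times> 'z \<Rightarrow> real"
  assumes growth: "sublinear_growth f"
    and cont: "continuous_on ({0..} \<times> UNIV \<times> UNIV) (\<lambda>(t, x, p). f0 t x p)"
    and P: "compact P'"
    and I: "openin (top_of_set {0..}) I" "t \<in> I" and w: "w \<in> \<W>"
    and Z: "open Z" "z0 \<in> Z"
    and DPP: "enjoys_DPP f f0 (\<lambda>t b. ereal (V t b))"
    and Rpos: "0 < R t w"
    and Rlip: "locally_lipschitz_on (I \<times> \<W>) (\<lambda>(t, w). R t w)"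
    and V: "\<And>t w z. t \<in> I \<Longrightarrow> w \<in> \<W> \<Longrightarrow> z \<in> Z \<Longrightarrow> V t (w, z) = R t w * S z"
    and Z': "open Z'" "z0 \<in> Z'" and L: "0 < L"
    and Q: "\<And>y z. y \<in> Z' \<Longrightarrow> z \<in> Z' \<Longrightarrow> optimal_time f P' \<W> t (w, y) z \<le> ereal (L * norm (y - z))"
  obtains \<epsilon> K where "0 < \<epsilon>" "0 \<le> K"
    "\<And>y z. y \<in> ball z0 \<epsilon> \<Longrightarrow> z \<in> ball z0 \<epsilon> \<Longrightarrow> S y - S z \<le> K * (1 + \<bar>S z\<bar>) * dist y z"
proof -
  have t: "0 \<le> t" using I openin_imp_subset by fastforce
  obtain h1 C M where h1: "0 < h1" and C: "0 \<le> C" and M: "0 \<le> M"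
    and short: "\<And>b u x \<tau>. \<lbrakk>dist b (w, z0) < h1; \<forall>s\<ge>0. u s \<in> P'; motion f b t u x; 0 \<le> \<tau>; \<tau> < h1\<rbrakk> \<Longrightarrow>
       dist (x (t + \<tau>)) b \<le> C * \<tau> \<and> (\<forall>s\<in>{t..t+\<tau>}. \<bar>f0 s (x s) (u s)\<bar> \<le> M)"
    using short_motions[OF growth cont P t] by blast
  obtain dI where dI: "0 < dI" "\<And>s. 0 \<le> s \<Longrightarrow> dist s t < dI \<Longrightarrow> s \<in> I"
    using I unfolding openin_euclidean_subtopology_iff by (metis atLeast_iff)
  obtain dR LR where dR: "0 < dR"
    and LR: "LR-lipschitz_on (cball (t, w) dR \<inter> (I \<times> \<W>)) (\<lambda>(t, w). R t w)"
    using Rlip I w unfolding locally_lipschitz_on_def by blast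
  have LR0: "0 \<le> LR" using LR by (rule lipschitz_on_nonneg)
  obtain dZ where dZ: "0 < dZ" "ball z0 dZ \<subseteq> Z \<inter> Z'"
    using Z Z' by (meson IntI open_Int openE)
  (* Times below h keep the bounds on motions valid, keep t + \<tau> in I, and keep (t + \<tau>, v), which is
     within (1 + C) * \<tau> of (t, w), in the ball where R is Lipschitz. *)
  define h where "h = min (min h1 dI) (dR / (1 + C))"
  have h: "0 < h" "h \<le> h1" "h \<le> dI" "h \<le> dR / (1 + C)"
    using h1 dI dR C unfolding h_def by auto
  then have hR: "(1 + C) * h \<le> dR" using C by (simp add: field_simps)
  define \<epsilon> where "\<epsilon> = min (min h1 dZ) (h / (2 * L))"
  have \<epsilon>: "0 < \<epsilon>" "\<epsilon> \<le> h1" "\<epsilon> \<le> dZ" "\<epsilon> \<le> h / (2 * L)"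
    using h1 dZ h L unfolding \<epsilon>_def by auto
  define k where "k = M + LR * (1 + C)"
  have k: "0 \<le> k" unfolding k_def using M LR0 C by simp
  have incr: "S y - S z \<le> (k * L / R t w) * (1 + \<bar>S z\<bar>) * dist y z"
    if yz: "y \<in> ball z0 \<epsilon>" "z \<in> ball z0 \<epsilon>" for y z
  proof -
    have inZ: "y \<in> Z" "z \<in> Z" "y \<in> Z'" "z \<in> Z'" using yz dZ \<epsilon>(3) by auto
    have "dist y z < 2 * \<epsilon>"
      using yz dist_triangle[of y z z0] by (auto simp: dist_commute)
    also have "2 * \<epsilon> \<le> h / L" using \<epsilon>(4) by simp
    finally have "L * dist y z < h" using L by (simp add: field_simps)
    moreover have "0 \<le> k * (1 + \<bar>S z\<bar>)" using k by simp
    (* The infimum defining the optimal time may not be attained (for y = z the bound is even 0), so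
       \<sigma> exceeds L * dist y z and tends to it at the end. *)
    moreover have "R t w * (S y - S z) \<le> k * (1 + \<bar>S z\<bar>) * \<sigma>"
      if \<sigma>: "L * dist y z < \<sigma>" "\<sigma> < h" for \<sigma>
    proof -
      have "optimal_time f P' \<W> t (w, y) z < ereal \<sigma>"
        using Q[OF inZ(3,4)] \<sigma>(1) by (auto simp: dist_norm intro: le_less_trans)
      then obtain \<tau> u x where \<tau>: "0 \<le> \<tau>" "\<tau> < \<sigma>" and u: "u \<in> controls" "\<forall>t\<ge>0. u t \<in> P'"
        and mot: "motion f (w, y) t u x" and end_in: "x (t + \<tau>) \<in> \<W> \<times> {z}"
        unfolding optimal_time_def Inf_less_iff by auto
      obtain v where v: "v \<in> \<W>" and xend: "x (t + \<tau>) = (v, z)" using end_in by auto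
      have dist0: "dist (w, y) (w, z0) < h1" using yz \<epsilon> by (simp add: dist_Pair_Pair dist_commute)
      have disp: "dist (v, z) (w, y) \<le> C * \<tau>"
        and cost: "\<And>s. s \<in> {t..t+\<tau>} \<Longrightarrow> \<bar>f0 s (x s) (u s)\<bar> \<le> M"
        using short[OF dist0 u(2) mot \<tau>(1)] \<tau> \<sigma> h xend by auto
      have tI: "t + \<tau> \<in> I" using dI(2) t \<tau> \<sigma> h by (simp add: dist_real_def)
      have "dist v w \<le> C * \<tau>" using disp dist_fst_le[of "(v, z)" "(w, y)"] by simp
      moreover have "dist (t + \<tau>, v) (t, w) \<le> dist (t + \<tau>) t + dist v w"
        by (simp add: dist_Pair_Pair sqrt_sum_squares_le_sum)
      ultimately have near: "dist (t + \<tau>, v) (t, w) \<le> (1 + C) * \<tau>"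
        using \<tau> by (simp add: dist_real_def algebra_simps)
      also have "\<dots> \<le> (1 + C) * h" using \<tau> \<sigma> C by (intro mult_left_mono) auto
      finally have "dist (t + \<tau>, v) (t, w) \<le> dR" using hR by simp
      then have "dist (R (t + \<tau>) v) (R t w) \<le> LR * dist (t + \<tau>, v) (t, w)"
        using lipschitz_onD[OF LR, of "(t + \<tau>, v)" "(t, w)"] tI v I w dR
        by (simp add: dist_commute)
      also have "\<dots> \<le> LR * ((1 + C) * \<tau>)" using near LR0 by (rule mult_left_mono)
      finally have "\<bar>R (t + \<tau>) v - R t w\<bar> \<le> LR * (1 + C) * \<tau>"
        by (simp add: dist_real_def mult_ac)
      then have "\<bar>R (t + \<tau>) v - R t w\<bar> * \<bar>S z\<bar> \<le> LR * (1 + C) * \<tau> * \<bar>S z\<bar>"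
        by (rule mult_right_mono) simp
      then have dR_le: "(R (t + \<tau>) v - R t w) * S z \<le> LR * (1 + C) * \<tau> * \<bar>S z\<bar>"
        by (metis abs_le_D1 abs_mult)
      have "V t (w, y) \<le> M * \<tau> + V (t + \<tau>) (x (t + \<tau>))"
        by (rule DPP_upper_bound[OF DPP t \<tau>(1) M u(1) mot]) (use cost abs_le_D1 in blast)
      then have "R t w * S y \<le> M * \<tau> + R (t + \<tau>) v * S z"
        using V[OF I(2) w inZ(1)] V[OF tI v inZ(2)] xend by simp
      then have "R t w * (S y - S z) \<le> M * \<tau> + (R (t + \<tau>) v - R t w) * S z"
        by (simp add: algebra_simps)
      also have "\<dots> \<le> M * \<tau> + LR * (1 + C) * \<tau> * \<bar>S z\<bar>" using dR_le by simp
      also have "\<dots> \<le> M * \<tau> * (1 + \<bar>S z\<bar>) + LR * (1 + C) * \<tau> * (1 + \<bar>S z\<bar>)"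
        using M LR0 C \<tau> by (intro add_mono mult_left_mono) (auto simp: algebra_simps)
      also have "\<dots> = k * (1 + \<bar>S z\<bar>) * \<tau>" unfolding k_def by (simp add: algebra_simps)
      also have "\<dots> \<le> k * (1 + \<bar>S z\<bar>) * \<sigma>" using k \<tau> by (intro mult_left_mono) auto
      finally show ?thesis .
    qed
    ultimately have "R t w * (S y - S z) \<le> k * (1 + \<bar>S z\<bar>) * (L * dist y z)"
      by (rule le_mult_limit)
    then show ?thesis using Rpos by (simp add: field_simps)
  qed
  show ?thesis
    by (rule that[OF \<epsilon>(1) _ incr]) (use k L Rpos in auto)
qed

theorem theorem6p1:
  fixes f :: "real \<Rightarrow>
              'w::{real_inner, banach, second_countable_topology} \<times>
              'z::{real_inner, banach, second_countable_topology} \<Rightarrow>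
              'p::polish_space \<Rightarrow> 'w \<times> 'z"
    and f0 :: "real \<Rightarrow> 'w \<times> 'z \<Rightarrow> 'p \<Rightarrow> real"
    and \<W> W :: "'w set" and Z :: "'z set" and I :: "real set" and P' :: "'p set"
    and V :: "real \<Rightarrow> 'w \<times> 'z \<Rightarrow> real"
    and R :: "real \<Rightarrow> 'w \<Rightarrow> real" and S :: "'z \<Rightarrow> real"
  assumes "finite_dimensional TYPE('w)" and "finite_dimensional TYPE('z)"
    and "continuous_on ({0..} \<times> UNIV \<times> UNIV) (\<lambda>(t, x, p). f t x p)"
    and "local_lipschitz ({0..} \<times> UNIV) UNIV (\<lambda>(t, p) x. f t x p)"
    and "sublinear_growth f"
    and "continuous_on ({0..} \<times> UNIV \<times> UNIV) (\<lambda>(t, x, p). f0 t x p)"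
    and "local_lipschitz ({0..} \<times> UNIV) UNIV (\<lambda>(t, p) x. f0 t x p)"
    and "compact P'"
    and "openin (top_of_set {0..}) I" and "I \<noteq> {}"
    and "open W" and "W \<subseteq> interior \<W>" and "W \<noteq> {}"
    and "open Z" and "Z \<noteq> {}"
    and "enjoys_DPP f f0 (\<lambda>t b. ereal (V t b))"
    and "\<forall>t\<in>I. \<forall>w\<in>\<W>. 0 < R t w"
    and "locally_lipschitz_on (I \<times> \<W>) (\<lambda>(t, w). R t w)"
    and "\<forall>t\<in>I. \<forall>w\<in>\<W>. \<forall>z\<in>Z. V t (w, z) = R t w * S z"
    and "\<forall>t\<in>I. \<forall>w\<in>W. \<forall>z\<in>Z. \<exists>I' W' Z' L.
           openin (top_of_set {0..}) I' \<and> t \<in> I' \<and> open W' \<and> w \<in> W' \<and> open Z' \<and> z \<in> Z' \<and> 0 < L \<and>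
           (\<forall>t'\<in>I'. \<forall>w'\<in>W'. \<forall>z\<^sub>1\<in>Z'. \<forall>z'\<in>Z'.
              optimal_time f P' \<W> t' (w', z') z\<^sub>1 \<le> ereal (L * norm (z' - z\<^sub>1)))"
  shows "locally_lipschitz_on (I \<times> W \<times> Z) (\<lambda>(t, w, z). V t (w, z))"
proof -
  note I = assms(9,10) and W = assms(12,13) and Z = assms(14)
    and R = assms(17,18) and V = assms(19) and Q = assms(20)
  obtain t w where t: "t \<in> I" and w: "w \<in> W" using I W by blast
  then have w\<W>: "w \<in> \<W>" using W interior_subset by blast
  have S_lip: "locally_lipschitz_on Z S"
    unfolding locally_lipschitz_on_def
  proof
    fix z0 assume z0: "z0 \<in> Z"
    obtain I' W' Z' L where *: "t \<in> I'" "w \<in> W'" "open Z'" "z0 \<in> Z'" "0 < L"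
      "\<forall>t'\<in>I'. \<forall>w'\<in>W'. \<forall>z\<^sub>1\<in>Z'. \<forall>z'\<in>Z'.
         optimal_time f P' \<W> t' (w', z') z\<^sub>1 \<le> ereal (L * norm (z' - z\<^sub>1))"
      using Q[rule_format, OF t w z0] by blast
    obtain \<epsilon> K where "0 < \<epsilon>" "0 \<le> K"
      "\<And>y z. y \<in> ball z0 \<epsilon> \<Longrightarrow> z \<in> ball z0 \<epsilon> \<Longrightarrow> S y - S z \<le> K * (1 + \<bar>S z\<bar>) * dist y z"
      by (rule factor_increment[where R = R and L = L and S = S,
            OF assms(5,6,8) I(1) t w\<W> Z z0 assms(16) _ R(2) _ *(3,4,5)])
        (use R(1) t w\<W> V * in auto)
    then obtain \<eta> L' where "0 < \<eta>" "L'-lipschitz_on (cball z0 \<eta>) S"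
      using lipschitz_near_if_self_bounding_increments by metis
    then show "\<exists>\<epsilon>>0. \<exists>L. L-lipschitz_on (cball z0 \<epsilon> \<inter> Z) S"
      by (meson inf_le1 lipschitz_on_subset)
  qed
  let ?X = "I \<times> W \<times> Z"
  have "locally_lipschitz_on ?X (\<lambda>x. (\<lambda>(t, w). R t w) (fst x, fst (snd x)))"
  proof (rule locally_lipschitz_on_compose_nonexpansive[OF R(2)])
    show "(\<lambda>x. (fst x, fst (snd x))) ` ?X \<subseteq> I \<times> \<W>" using W interior_subset by fastforce
  next
    fix x y :: "real \<times> 'w \<times> 'z"
    have "(dist (fst (snd x)) (fst (snd y)))\<^sup>2 \<le> (dist (snd x) (snd y))\<^sup>2"
      by (intro power_mono dist_fst_le) simp
    then show "dist (fst x, fst (snd x)) (fst y, fst (snd y)) \<le> dist x y"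
      by (simp add: dist_prod_def)
  qed
  moreover have "locally_lipschitz_on ?X (\<lambda>x. S (snd (snd x)))"
    by (rule locally_lipschitz_on_compose_nonexpansive[OF S_lip])
      (auto intro: order_trans[OF dist_snd_le] dist_snd_le)
  ultimately have "locally_lipschitz_on ?X
      (\<lambda>x. (\<lambda>(t, w). R t w) (fst x, fst (snd x)) * S (snd (snd x)))"
    by (rule locally_lipschitz_on_mult)
  then show ?thesis
  proof (rule locally_lipschitz_on_transform)
    fix x assume "x \<in> ?X"
    then show "(\<lambda>(t, w). R t w) (fst x, fst (snd x)) * S (snd (snd x)) = (\<lambda>(t, w, z). V t (w, z)) x"
      using V W interior_subset by fastforce
  qed
qed

end
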